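(* For every $\varepsilon>0$ there is a constant $C_\varepsilon$ such that the following holds. Let $N\geq 1$ be an integer, and suppose that for each odd prime $p\leq\sqrt{N}$ one is given an interval $I_p\subseteq\mathbb{Z}/p\mathbb{Z}$ of length $(p-1)/2$. Let $A\subseteq\{1,\dots,N\}$ be the set obtained by removing from $\{1,\dots,N\}$ every $n$ for which $n \bmod p$ lies in $I_p$ for some odd prime $p\leq\sqrt{N}$. Then $|A|\leq C_\varepsilon N^{1/3+\varepsilon}$ (the constant being independent of the choice of the intervals $I_p$).
   Context: An interval of length $L$ in $\mathbb{Z}/p\mathbb{Z}$ is a set of the form $\{a, a+1,\dots,a+L-1\} \pmod p$ for some $a\in\mathbb{Z}/p\mathbb{Z}$. The paper states the conclusion as $|A|\ll N^{1/3+o(1)}$. *)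

theory Defs
  imports Complex_Main "HOL-Computational_Algebra.Primes"
begin

(* Elements of Z/mZ are represented by their canonical representatives 0, ..., m - 1. *)
definition interval_mod :: "nat \<Rightarrow> nat \<Rightarrow> nat set \<Rightarrow> bool" where
  "interval_mod m L J \<longleftrightarrow> (\<exists>a<m. J = (\<lambda>k. (a + k) mod m) ` {..<L})"

definition sieving_primes :: "nat \<Rightarrow> nat set" where
  "sieving_primes N = {p. prime p \<and> odd p \<and> real p \<le> sqrt (real N)}"

definition sieved_set :: "nat \<Rightarrow> (nat \<Rightarrow> nat set) \<Rightarrow> nat set" where
  "sieved_set N I = {1..N} - {n. \<exists>p\<in>sieving_primes N. n mod p \<in> I p}"

end

theory Submission
  imports Defs "HOL-Analysis.Harmonic_Numbers" "HOL-Real_Asymp.Real_Asymp"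
begin

text \<open>Let \<open>f x = 2 * cos (2 * pi * x) - cos (4 * pi * x)\<close>. It has mean zero and \<open>f x \<ge> 1\<close> for
  \<open>\<bar>x\<bar> \<le> 1 / 4\<close>. The residues modulo \<open>p\<close> that survive the sieve form an interval of length
  \<open>(p + 1) / 2\<close>, so with \<open>c p\<close> its centre divided by \<open>p\<close>, every survivor \<open>n\<close> has
  \<open>f (n / p - c p) \<ge> 1\<close>. Take the primes \<open>p \<le> P = N powr (1 / 5)\<close> from 13 on and the primes \<open>q\<close>
  with \<open>8 * P^2 \<le> q \<le> Q = sqrt N\<close>. The product of the sum of \<open>f (n / p - c p)\<close> over these \<open>p\<close>
  with the corresponding sum over \<open>q\<close> is at least \<open>M = (number of p) * (number of q)\<close> at each
  survivor. It is a trigonometric polynomial with \<open>16 * M\<close> bounded coefficients and well spaced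
  frequencies \<open>j / p + k / q\<close>, where \<open>j\<close> and \<open>k\<close> lie in \<open>{-2, -1, 1, 2}\<close>. Expanding its square
  and bounding geometric sums, the sum of its square over \<open>n \<le> N\<close> is \<open>O(M * N)\<close> up to logarithms,
  so there are \<open>O(N / M)\<close> survivors up to logarithms. With Chebyshev's lower bound for the number of
  primes this is \<open>N powr (3 / 10)\<close> up to logarithms.\<close>

subsection \<open>Chebyshev's lower bound\<close>

text \<open>The numbers 1 / (m * (n choose m)) form the Leibniz harmonic triangle, in which every entry
  is a difference of two entries nearer to the edge 1 / n.\<close>

lemma mult_binomial_dvd:
  fixes E :: nat
  assumes "1 \<le> m" "m \<le> n" "\<And>i. i \<in> {1..n} \<Longrightarrow> i dvd E"
  shows "m * (n choose m) dvd E"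
  using assms
proof (induction m arbitrary: n rule: nat_induct_at_least)
  case base
  then show ?case by simp
next
  case (Suc m)
  obtain k where n: "n = Suc k" and "m \<le> k"
    using Suc.prems(1) by (cases n) auto
  obtain a where a: "E = m * (n choose m) * a"
    using Suc.IH[of n] Suc.prems by (auto elim: dvdE)
  obtain b where b: "E = m * (k choose m) * b"
    using Suc.IH[of k] Suc.prems \<open>m \<le> k\<close> n by (auto elim: dvdE)
  define d where "d = n - m"
  have d: "n = m + d" "d > 0" using \<open>m \<le> k\<close> n d_def by auto
  have row: "Suc m * (n choose Suc m) = d * (n choose m)"
    using binomial_absorb_comp[of n m] binomial_absorption[of m n] d_def by simp
  have diag: "d * (n choose m) = n * (k choose m)"
    using binomial_absorb_comp[of n m] n d_def by simp
  \<comment> \<open>This is 1 / ((m+1) C(n,m+1)) = 1 / (m C(n-1,m)) - 1 / (m C(n,m)) cleared of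
    denominators. In the integers \<open>b - a\<close> is a genuine difference.\<close>
  have "int (Suc m * (n choose Suc m)) * (int b - int a) = int E"
  proof -
    have "m * (int (d * (n choose m)) * int b) = n * int E"
      unfolding diag by (subst b) simp
    moreover have "m * (int (d * (n choose m)) * int a) = d * int E"
      by (subst a) simp
    ultimately have "m * (int (d * (n choose m)) * (int b - int a)) = m * int E"
      using d by (simp add: algebra_simps)
    then show ?thesis using row \<open>1 \<le> m\<close> by simp
  qed
  then have "int (Suc m * (n choose Suc m)) dvd int E"
    by (metis dvd_triv_left)
  then show ?case using int_dvd_int_iff by blast
qed

definition primes_upto :: "nat \<Rightarrow> nat set" where
  "primes_upto n = {p. prime p \<and> p \<le> n}"

lemma finite_primes_upto [simp]: "finite (primes_upto n)"
  unfolding primes_upto_def by (rule finite_subset[of _ "{..n}"]) auto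

text \<open>The witness is the lcm of 1, ..., n: the product of the largest powers
  \<open>p ^ k p\<close> not exceeding \<open>n\<close>, so that each prime costs a factor of at
  most \<open>n\<close>.\<close>

lemma common_multiple_le_power_primes:
  fixes n :: nat
  assumes "n \<ge> 1"
  obtains E where "E > 0" "\<And>i. i \<in> {1..n} \<Longrightarrow> i dvd E" "E \<le> n ^ card (primes_upto n)"
proof -
  have "\<exists>k. p ^ k \<le> n \<and> n < p ^ (k + 1)" if "p \<in> primes_upto n" for p
    using ex_power_ivl1[of p n] that assms prime_ge_2_nat by (auto simp: primes_upto_def)
  then obtain k where k: "\<And>p. p \<in> primes_upto n \<Longrightarrow> p ^ k p \<le> n \<and> n < p ^ (k p + 1)"
    by metis
  define E where "E = (\<Prod>p\<in>primes_upto n. p ^ k p)"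
  have "E > 0"
    unfolding E_def by (intro prod_pos) (auto simp: primes_upto_def prime_gt_0_nat)
  moreover have "i dvd E" if i: "i \<in> {1..n}" for i
  proof -
    have "i = (\<Prod>p\<in>prime_factors i. p ^ multiplicity p i)"
      using i by (intro prime_factorization_nat) auto
    also have "\<dots> dvd E"
      unfolding E_def
    proof (rule prod_dvd_prod_subset2)
      show sub: "prime_factors i \<subseteq> primes_upto n"
        using i by (auto simp: primes_upto_def prime_factors_dvd dest: dvd_imp_le)
      fix p assume p: "p \<in> prime_factors i"
      have "p ^ multiplicity p i \<le> i"
        using i multiplicity_dvd[of p i] by (auto intro!: dvd_imp_le)
      also have "i < p ^ (k p + 1)"
        using k[of p] sub p i by auto
      finally have "multiplicity p i < k p + 1"
        using prime_gt_1_nat[OF in_prime_factors_imp_prime[OF p]]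
        by (rule power_less_imp_less_exp[rotated])
      then show "p ^ multiplicity p i dvd p ^ k p"
        by (intro le_imp_power_dvd) simp
    qed simp
    finally show ?thesis .
  qed
  moreover have "E \<le> n ^ card (primes_upto n)"
    unfolding E_def using k prod_mono[of "primes_upto n" "\<lambda>p. p ^ k p" "\<lambda>_. n"] by simp
  ultimately show ?thesis using that by blast
qed

text \<open>The central binomial coefficient is at least 2^n / (n+1), and \<open>m\<close> times it
  divides the common multiple \<open>E\<close>. The extra \<open>m\<close> absorbs n+1 up to a
  factor 4 = 2^2, whence \<open>n - 2\<close> instead of \<open>n\<close>.\<close>

lemma card_primes_upto_ge:
  assumes "n \<ge> 2"
  shows "(real n - 2) * ln 2 \<le> real (card (primes_upto n)) * ln (real n)"
proof -
  define m where "m = n div 2"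
  have m: "1 \<le> m" "m \<le> n" "n \<le> 2 * m + 1" using assms by (auto simp: m_def)
  obtain E where E: "E > 0" "\<And>i. i \<in> {1..n} \<Longrightarrow> i dvd E" "E \<le> n ^ card (primes_upto n)"
    using common_multiple_le_power_primes[of n] assms by auto
  have "2 ^ n = (\<Sum>k\<le>n. n choose k)" by (simp add: choose_row_sum)
  also have "\<dots> \<le> (\<Sum>k\<le>n. n choose m)"
    unfolding m_def by (intro sum_mono binomial_maximum)
  also have "\<dots> = (n + 1) * (n choose m)" by simp
  also have "\<dots> \<le> 4 * m * (n choose m)"
    using m by (intro mult_right_mono) auto
  also have "\<dots> \<le> 4 * E"
    using dvd_imp_le[OF mult_binomial_dvd[of m n E]] m E by simp
  also have "\<dots> \<le> 4 * n ^ card (primes_upto n)" using E by simp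
  finally have "real (2 ^ n) \<le> real (4 * n ^ card (primes_upto n))"
    by (simp only: of_nat_le_iff)
  then have "2 ^ n \<le> 2 ^ 2 * real n ^ card (primes_upto n)" by simp
  then have "ln (2 ^ n) \<le> ln (2 ^ 2 * real n ^ card (primes_upto n))"
    using assms by (subst ln_le_cancel_iff) auto
  then show ?thesis
    using assms ln_realpow[of 2 2] by (simp add: ln_mult ln_realpow algebra_simps)
qed

subsection \<open>Exponential sums\<close>

text \<open>On this range cos (pi t) is at least 1/2, so \<open>sin (pi * t) - t\<close> has
  derivative at least pi/2 - 1.\<close>

lemma sin_pi_mult_ge:
  fixes x :: real
  assumes "0 \<le> x" "x \<le> 1 / 3"
  shows "x \<le> sin (pi * x)"
proof -
  have "sin (pi * 0) - 0 \<le> sin (pi * x) - x"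
  proof (rule DERIV_nonneg_imp_nondecreasing[of 0 x "\<lambda>t. sin (pi * t) - t"])
    fix t assume t: "0 \<le> t" "t \<le> x"
    have "cos (pi / 3) \<le> cos (pi * t)"
      using t assms by (intro cos_monotone_0_pi_le) (auto simp: field_simps)
    then have "1 / 2 \<le> cos (pi * t)" by (simp add: cos_60)
    then have "2 * (1 / 2) \<le> pi * cos (pi * t)"
      using pi_ge_two by (intro mult_mono) auto
    then have "0 \<le> cos (pi * t) * pi - 1" by (simp add: mult.commute)
    moreover have "((\<lambda>t. sin (pi * t) - t) has_real_derivative cos (pi * t) * pi - 1) (at t)"
      by (auto intro!: derivative_eq_intros)
    ultimately show "\<exists>y. ((\<lambda>t. sin (pi * t) - t) has_real_derivative y) (at t) \<and> 0 \<le> y"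
      by blast
  qed (use assms in auto)
  then show ?thesis by simp
qed

text \<open>The chord from 1 to cis (2 pi x) has length 2 |sin (pi x)|.\<close>

lemma norm_one_minus_cis_ge:
  fixes x :: real
  assumes "\<bar>x\<bar> \<le> 1 / 3"
  shows "2 * \<bar>x\<bar> \<le> norm (1 - cis (2 * pi * x))"
proof (rule power2_le_imp_le)
  have "\<bar>x\<bar> \<le> sin (pi * \<bar>x\<bar>)" using assms by (intro sin_pi_mult_ge) auto
  then have "\<bar>x\<bar>\<^sup>2 \<le> (sin (pi * \<bar>x\<bar>))\<^sup>2" by (intro power_mono) auto
  also have "(sin (pi * \<bar>x\<bar>))\<^sup>2 = (sin (pi * x))\<^sup>2"
    by (cases "x \<ge> 0") auto
  finally have sq: "x\<^sup>2 \<le> (sin (pi * x))\<^sup>2" by simp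
  have "(norm (1 - cis (2 * pi * x)))\<^sup>2 = 2 - 2 * cos (2 * (pi * x))"
    using sin_cos_squared_add[of "2 * pi * x"]
    by (simp add: cmod_power2 power2_diff algebra_simps)
  also have "\<dots> = 4 * (sin (pi * x))\<^sup>2"
    by (simp add: cos_double_sin)
  finally show "(2 * \<bar>x\<bar>)\<^sup>2 \<le> (norm (1 - cis (2 * pi * x)))\<^sup>2"
    using sq by (simp add: power_mult_distrib)
qed simp

text \<open>A geometric sum: multiplied by 1 - z it has norm at most 2. The range of
  \<open>x\<close> makes \<open>\<bar>x\<bar>\<close> its distance to the nearest integer.\<close>

lemma norm_sum_cis_le:
  fixes x :: real
  assumes "x \<noteq> 0" "\<bar>x\<bar> \<le> 1 / 3"
  shows "norm (\<Sum>n=1..N. cis (2 * pi * real n * x)) \<le> 1 / \<bar>x\<bar>"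
proof -
  define z where "z = cis (2 * pi * x)"
  define S where "S = (\<Sum>n<N. z ^ n)"
  have "(\<Sum>n=1..N. cis (2 * pi * real n * x)) = (\<Sum>n=1..N. z ^ n)"
    unfolding z_def Complex.DeMoivre by (intro sum.cong) (simp_all add: mult_ac)
  also have "\<dots> = (\<Sum>n<N. z ^ Suc n)"
    by (rule sum.reindex_bij_witness[of _ Suc "\<lambda>n. n - 1"]) auto
  also have "\<dots> = z * S"
    unfolding S_def by (simp add: sum_distrib_left)
  finally have "norm (\<Sum>n=1..N. cis (2 * pi * real n * x)) = norm S"
    by (simp add: norm_mult z_def)
  moreover have "2 * \<bar>x\<bar> * norm S \<le> 2"
  proof -
    have "2 * \<bar>x\<bar> * norm S \<le> norm (1 - z) * norm S"
      unfolding z_def using norm_one_minus_cis_ge[OF assms(2)] by (intro mult_right_mono) auto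
    also have "\<dots> = norm (1 - z ^ N)"
      unfolding S_def norm_mult[symmetric] by (simp add: one_diff_power_eq)
    also have "\<dots> \<le> norm (1::complex) + norm (z ^ N)" by (rule norm_triangle_ineq4)
    also have "\<dots> = 2" by (simp add: z_def norm_power)
    finally show ?thesis .
  qed
  ultimately show ?thesis using assms by (simp add: field_simps)
qed

text \<open>Expanding the square and summing over \<open>n\<close> first leaves a quadratic form in
  \<open>c\<close> whose matrix consists of geometric sums; \<open>B\<close> bounds each row sum of
  their norms.\<close>

lemma sum_norm_square_exponential_le:
  fixes c :: "'t \<Rightarrow> complex" and \<theta> :: "'t \<Rightarrow> real"
  assumes "finite T" and c: "\<And>t. t \<in> T \<Longrightarrow> norm (c t) \<le> 1"
    and B: "\<And>t. t \<in> T \<Longrightarrow>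
      (\<Sum>u\<in>T. norm (\<Sum>n=1..N. cis (2 * pi * real n * (\<theta> t - \<theta> u)))) \<le> B"
  shows "(\<Sum>n=1..N. (norm (\<Sum>t\<in>T. c t * cis (2 * pi * real n * \<theta> t)))\<^sup>2) \<le> real (card T) * B"
proof -
  let ?D = "\<lambda>t u. \<Sum>n=1..N. cis (2 * pi * real n * (\<theta> t - \<theta> u))"
  let ?G = "\<lambda>n::nat. \<Sum>t\<in>T. c t * cis (2 * pi * real n * \<theta> t)"
  have eq: "of_real ((norm (?G n))\<^sup>2) =
     (\<Sum>t\<in>T. \<Sum>u\<in>T. c t * cnj (c u) * cis (2 * pi * real n * (\<theta> t - \<theta> u)))" for n :: nat
    unfolding complex_norm_square cnj_sum sum_product
  proof (intro sum.cong refl)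
    fix t u
    have "cis (2 * pi * real n * (\<theta> t - \<theta> u)) =
        cis (2 * pi * real n * \<theta> t) * cnj (cis (2 * pi * real n * \<theta> u))"
      by (simp add: cis_cnj cis_mult right_diff_distrib)
    then show "c t * cis (2 * pi * real n * \<theta> t) * cnj (c u * cis (2 * pi * real n * \<theta> u)) =
        c t * cnj (c u) * cis (2 * pi * real n * (\<theta> t - \<theta> u))"
      by (simp only: complex_cnj_mult mult_ac)
  qed
  let ?f = "\<lambda>n t u. c t * cnj (c u) * cis (2 * pi * real n * (\<theta> t - \<theta> u))"
  have "of_real (\<Sum>n=1..N. (norm (?G n))\<^sup>2) = (\<Sum>n=1..N. \<Sum>t\<in>T. \<Sum>u\<in>T. ?f n t u)"
    by (simp only: of_real_sum eq)
  also have "\<dots> = (\<Sum>t\<in>T. \<Sum>n=1..N. \<Sum>u\<in>T. ?f n t u)"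
    by (rule sum.swap)
  also have "\<dots> = (\<Sum>t\<in>T. \<Sum>u\<in>T. \<Sum>n=1..N. ?f n t u)"
    by (intro sum.cong refl sum.swap)
  also have "\<dots> = (\<Sum>t\<in>T. \<Sum>u\<in>T. c t * cnj (c u) * ?D t u)"
    by (simp only: sum_distrib_left)
  finally have G: "complex_of_real (\<Sum>n=1..N. (norm (?G n))\<^sup>2) =
    (\<Sum>t\<in>T. \<Sum>u\<in>T. c t * cnj (c u) * ?D t u)" .
  have "(\<Sum>n=1..N. (norm (?G n))\<^sup>2) \<le> norm (complex_of_real (\<Sum>n=1..N. (norm (?G n))\<^sup>2))"
    unfolding norm_of_real by (rule abs_ge_self)
  also have "\<dots> = norm (\<Sum>t\<in>T. \<Sum>u\<in>T. c t * cnj (c u) * ?D t u)"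
    unfolding G by (rule refl)
  also have "\<dots> \<le> (\<Sum>t\<in>T. \<Sum>u\<in>T. norm (?D t u))"
  proof (intro sum_norm_le)
    fix t u assume "t \<in> T" "u \<in> T"
    then have "norm (c t) * norm (c u) \<le> 1"
      using c by (intro mult_le_one) auto
    then show "norm (c t * cnj (c u) * ?D t u) \<le> norm (?D t u)"
      unfolding norm_mult complex_mod_cnj by (intro mult_left_le_one_le) auto
  qed
  also have "\<dots> \<le> (\<Sum>t\<in>T. B)" by (intro sum_mono B)
  finally show ?thesis by simp
qed

text \<open>By injectivity each absolute value in 1, ..., H occurs at most twice, once per
  sign.\<close>

lemma sum_inverse_inj_le_harm:
  fixes h :: "'s \<Rightarrow> int"
  assumes "finite S" "inj_on h S" "\<And>s. s \<in> S \<Longrightarrow> h s \<noteq> 0 \<and> \<bar>h s\<bar> \<le> int H"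
  shows "(\<Sum>s\<in>S. 1 / \<bar>real_of_int (h s)\<bar>) \<le> 2 * harm H"
proof -
  have "(\<Sum>s\<in>S. 1 / \<bar>real_of_int (h s)\<bar>) = (\<Sum>i\<in>h ` S. 1 / \<bar>real_of_int i\<bar>)"
    using assms(2) by (simp add: sum.reindex)
  also have "\<dots> \<le> (\<Sum>i\<in>int ` {1..H} \<union> (\<lambda>k. - int k) ` {1..H}. 1 / \<bar>real_of_int i\<bar>)"
  proof (intro sum_mono2)
    show "h ` S \<subseteq> int ` {1..H} \<union> (\<lambda>k. - int k) ` {1..H}"
    proof
      fix i assume "i \<in> h ` S"
      then have i: "i \<noteq> 0" "\<bar>i\<bar> \<le> int H" using assms(3) by auto
      then have "i = int (nat i) \<and> nat i \<in> {1..H} \<or> i = - int (nat (- i)) \<and> nat (- i) \<in> {1..H}"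
        by auto
      then show "i \<in> int ` {1..H} \<union> (\<lambda>k. - int k) ` {1..H}" by blast
    qed
  qed auto
  also have "\<dots> = (\<Sum>i\<in>int ` {1..H}. 1 / \<bar>real_of_int i\<bar>) + (\<Sum>i\<in>(\<lambda>k. - int k) ` {1..H}. 1 / \<bar>real_of_int i\<bar>)"
    by (intro sum.union_disjoint) auto
  also have "\<dots> = 2 * harm H"
    by (subst (1 2) sum.reindex) (auto simp: inj_on_def harm_def inverse_eq_divide)
  finally show ?thesis .
qed

subsection \<open>Spacing of the frequencies\<close>

text \<open>The frequencies of the trigonometric polynomial \<open>test\<close> below.\<close>

definition freqs :: "int set" where "freqs = {-2, -1, 1, 2}"

lemma finite_freqs [simp]: "finite freqs"
  and card_freqs [simp]: "card freqs = 4"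
  by (simp_all add: freqs_def)

lemma freqsD:
  assumes "k \<in> freqs"
  shows "k \<noteq> 0" "\<bar>k\<bar> \<le> 2" "\<bar>real_of_int k\<bar> \<le> 2"
  using assms by (auto simp: freqs_def)

lemma fraction_diff_eq:
  assumes "p > 0" "q > 0"
  shows "real_of_int j / real p - real_of_int k / real q =
    real_of_int (j * int q - k * int p) / (real p * real q)"
  using assms by (simp add: field_simps)

text \<open>If j q = k p with distinct primes, the odd prime p divides j, impossible as 1 \<le> |j|
  \<le> 2; if p = q, then j = k.\<close>

lemma fraction_numerator_nonzero:
  fixes p q :: nat
  assumes "prime p" "odd p" "prime q" "j \<in> freqs" "k \<in> freqs" "(q, k) \<noteq> (p, j)"
  shows "j * int q - k * int p \<noteq> 0"
proof
  assume "j * int q - k * int p = 0"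
  then have eq: "j * int q = k * int p" by simp
  show False
  proof (cases "q = p")
    case True
    then show ?thesis using eq assms prime_gt_0_nat[of p] by auto
  next
    case False
    have "int p dvd j * int q" using eq by simp
    moreover have "\<not> int p dvd int q"
      using False assms primes_dvd_imp_eq by auto
    ultimately have "int p dvd j"
      using \<open>prime p\<close> prime_dvd_mult_iff[of "int p" j "int q"] by auto
    moreover have "\<bar>j\<bar> \<le> 2" "j \<noteq> 0" using freqsD[OF assms(4)] by auto
    ultimately have "int p \<le> 2"
      using dvd_imp_le_int[of j "int p"] by linarith
    then show ?thesis using assms prime_ge_2_nat[of p] by (cases "p = 2") auto
  qed
qed

text \<open>For each of the four \<open>k\<close>, the numerators j q - k p are distinct as q
  varies, nonzero and at most 4X in size, so their reciprocals sum to at most twice a harmonic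
  number. The denominators are at most X^2.\<close>

lemma sum_inverse_fraction_diff_le:
  fixes R :: "nat set" and X :: nat
  assumes R: "finite R" "\<And>p. p \<in> R \<Longrightarrow> prime p \<and> odd p \<and> p \<le> X"
    and p: "p \<in> R" "j \<in> freqs"
  shows "(\<Sum>(q, k)\<in>R \<times> freqs - {(p, j)}. 1 / \<bar>real_of_int j / real p - real_of_int k / real q\<bar>)
    \<le> 8 * (real X)\<^sup>2 * harm (4 * X)"
proof -
  define h where "h k q = j * int q - k * int p" for k :: int and q :: nat
  define S where "S k = {q \<in> R. (q, k) \<noteq> (p, j)}" for k
  have bound: "(\<Sum>q\<in>S k. 1 / \<bar>real_of_int j / real p - real_of_int k / real q\<bar>)
      \<le> (real X)\<^sup>2 * (2 * harm (4 * X))" if k: "k \<in> freqs" for k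
  proof -
    have "(\<Sum>q\<in>S k. 1 / \<bar>real_of_int j / real p - real_of_int k / real q\<bar>)
      \<le> (\<Sum>q\<in>S k. (real X)\<^sup>2 * (1 / \<bar>real_of_int (h k q)\<bar>))"
    proof (rule sum_mono)
      fix q assume "q \<in> S k"
      then have q: "q \<in> R" by (simp add: S_def)
      have pos: "p > 0" "q > 0" using R p q prime_gt_0_nat by auto
      have "real p * real q \<le> (real X)\<^sup>2"
        unfolding power2_eq_square using R p q by (intro mult_mono) auto
      moreover have "1 / \<bar>real_of_int j / real p - real_of_int k / real q\<bar> =
          (real p * real q) * (1 / \<bar>real_of_int (h k q)\<bar>)"
        unfolding fraction_diff_eq[OF pos] h_def by (simp add: abs_mult)
      ultimately show "1 / \<bar>real_of_int j / real p - real_of_int k / real q\<bar> \<le>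
          (real X)\<^sup>2 * (1 / \<bar>real_of_int (h k q)\<bar>)"
        by (simp add: divide_right_mono)
    qed
    also have "\<dots> = (real X)\<^sup>2 * (\<Sum>q\<in>S k. 1 / \<bar>real_of_int (h k q)\<bar>)"
      by (simp add: sum_distrib_left)
    also have "\<dots> \<le> (real X)\<^sup>2 * (2 * harm (4 * X))"
    proof (intro mult_left_mono sum_inverse_inj_le_harm)
      show "finite (S k)" using R by (simp add: S_def)
      show "inj_on (h k) (S k)" using freqsD[OF p(2)] by (auto simp: inj_on_def h_def)
      fix q assume "q \<in> S k"
      then have q: "q \<in> R" "(q, k) \<noteq> (p, j)" by (auto simp: S_def)
      have "h k q \<noteq> 0"
        unfolding h_def using R p q k by (intro fraction_numerator_nonzero) auto
      moreover have "\<bar>h k q\<bar> \<le> 4 * int X"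
      proof -
        have "p \<le> X" "q \<le> X" using R p q by auto
        moreover have "\<bar>j * int q\<bar> \<le> 2 * int q" "\<bar>k * int p\<bar> \<le> 2 * int p"
          using freqsD[OF p(2)] freqsD[OF k] by (auto simp: abs_mult intro: mult_right_mono)
        ultimately show ?thesis unfolding h_def by linarith
      qed
      ultimately show "h k q \<noteq> 0 \<and> \<bar>h k q\<bar> \<le> int (4 * X)" by simp
    qed simp
    finally show ?thesis .
  qed
  have "(\<Sum>(q, k)\<in>R \<times> freqs - {(p, j)}. 1 / \<bar>real_of_int j / real p - real_of_int k / real q\<bar>)
    = (\<Sum>(k, q)\<in>Sigma freqs S. 1 / \<bar>real_of_int j / real p - real_of_int k / real q\<bar>)"
    by (rule sum.reindex_bij_witness[of _ "\<lambda>(k, q). (q, k)" "\<lambda>(q, k). (k, q)"])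
       (auto simp: S_def)
  also have "\<dots> = (\<Sum>k\<in>freqs. \<Sum>q\<in>S k. 1 / \<bar>real_of_int j / real p - real_of_int k / real q\<bar>)"
    using R by (intro sum.Sigma[symmetric]) (auto simp: S_def)
  also have "\<dots> \<le> (\<Sum>k\<in>freqs. (real X)\<^sup>2 * (2 * harm (4 * X)))"
    by (intro sum_mono bound)
  also have "\<dots> = 8 * (real X)\<^sup>2 * harm (4 * X)" by simp
  finally show ?thesis .
qed

text \<open>The numerator is a nonzero integer and the denominator at most X^2.\<close>

lemma fraction_diff_ge:
  fixes p q X :: nat
  assumes "prime p" "odd p" "prime q" "j \<in> freqs" "k \<in> freqs" "(q, k) \<noteq> (p, j)"
    and "p \<le> X" "q \<le> X"
  shows "1 / (real X)\<^sup>2 \<le> \<bar>real_of_int j / real p - real_of_int k / real q\<bar>"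
proof -
  have pos: "p > 0" "q > 0" using assms prime_gt_0_nat by auto
  have "1 \<le> \<bar>j * int q - k * int p\<bar>"
    using fraction_numerator_nonzero[OF assms(1-6)] by simp
  then have 1: "1 \<le> \<bar>real_of_int (j * int q - k * int p)\<bar>" by linarith
  have "real p * real q \<le> (real X)\<^sup>2"
    unfolding power2_eq_square using assms by (intro mult_mono) auto
  then have "1 / (real X)\<^sup>2 \<le> 1 / (real p * real q)"
    using pos assms(7) by (intro divide_left_mono) auto
  also have "\<dots> \<le> \<bar>real_of_int (j * int q - k * int p)\<bar> / (real p * real q)"
    using 1 by (intro divide_right_mono) auto
  finally show ?thesis
    unfolding fraction_diff_eq[OF pos] by (simp add: abs_mult)
qed

lemma half_abs_diff_le:
  fixes x y a b :: real
  assumes "\<bar>a\<bar> \<le> \<bar>x - y\<bar> / 4" "\<bar>b\<bar> \<le> \<bar>x - y\<bar> / 4"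
  shows "\<bar>x - y\<bar> / 2 \<le> \<bar>(x + a) - (y + b)\<bar>"
  using assms by (cases "x \<le> y") auto

text \<open>The primes in \<open>Qs\<close> are so large that adding \<open>k / q\<close> perturbs \<open>j / p\<close> by at most a quarter of
  the distance between two fractions \<open>j / p\<close>; the primes in \<open>Ps\<close> are at least 13 so that all
  differences of frequencies stay within 1 / 3 and never wrap around modulo 1.\<close>

locale two_scales =
  fixes Ps Qs :: "nat set" and P Q :: nat
  assumes Ps: "\<And>p. p \<in> Ps \<Longrightarrow> prime p \<and> odd p \<and> 13 \<le> p \<and> p \<le> P"
    and Qs: "\<And>q. q \<in> Qs \<Longrightarrow> prime q \<and> odd q \<and> 8 * P\<^sup>2 \<le> q \<and> q \<le> Q"
begin

lemma finite_Ps: "finite Ps"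
  using Ps by (intro finite_subset[of Ps "{..P}"]) auto

lemma finite_Qs: "finite Qs"
  using Qs by (intro finite_subset[of Qs "{..Q}"]) auto

lemma card_Qs_le: "card Qs \<le> Q"
proof -
  have "Qs \<subseteq> {1..Q}" using Qs prime_ge_1_nat by auto
  from card_mono[OF _ this] show ?thesis by simp
qed

definition T :: "((nat \<times> int) \<times> (nat \<times> int)) set" where
  "T = (Ps \<times> freqs) \<times> (Qs \<times> freqs)"

definition \<theta> :: "(nat \<times> int) \<times> (nat \<times> int) \<Rightarrow> real" where
  "\<theta> = (\<lambda>((p, j), (q, k)). real_of_int j / real p + real_of_int k / real q)"

lemma finite_T: "finite T"
  unfolding T_def using finite_Ps finite_Qs by auto

lemma card_T: "card T = 16 * card Ps * card Qs"
  by (simp add: T_def card_cartesian_product)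

section \<open>Row sums of the geometric sums\<close>

definition D :: "nat \<Rightarrow> real \<Rightarrow> real" where
  "D N x = norm (\<Sum>n=1..N. cis (2 * pi * real n * x))"

text \<open>The summands bound three pieces of a row: the diagonal entry, the entries sharing
  \<open>(p, j)\<close> but not \<open>(q, k)\<close>, and those with a different
  \<open>(p, j)\<close>.\<close>

definition B :: "nat \<Rightarrow> real" where
  "B N = real N + 8 * (real Q)\<^sup>2 * harm (4 * Q) + 64 * real Q * (real P)\<^sup>2 * harm (4 * P)"

text \<open>The bound is a quarter of the least gap 1 / P^2 between the fractions j / p.\<close>

lemma inner_freq_le:
  assumes "(q, k) \<in> Qs \<times> freqs" "P > 0"
  shows "\<bar>real_of_int k / real q\<bar> \<le> 1 / (4 * (real P)\<^sup>2)"
proof -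
  have q: "8 * P\<^sup>2 \<le> q" "0 < q" using assms Qs prime_gt_0_nat by auto
  then have q': "8 * (real P)\<^sup>2 \<le> real q" by (metis of_nat_le_iff of_nat_mult of_nat_numeral of_nat_power)
  have "\<bar>real_of_int k / real q\<bar> \<le> 2 / real q"
    using assms freqsD(3)[of k] by (simp add: divide_right_mono)
  also have "\<dots> \<le> 2 / (8 * (real P)\<^sup>2)"
    using q q' assms by (intro divide_left_mono mult_pos_pos) auto
  finally show ?thesis by simp
qed

lemma outer_freq_le:
  assumes "(p, j) \<in> Ps \<times> freqs"
  shows "\<bar>real_of_int j / real p\<bar> \<le> 2 / 13"
proof -
  have p: "13 \<le> p" using assms Ps by auto
  have "\<bar>real_of_int j / real p\<bar> \<le> 2 / real p"
    using assms freqsD(3)[of j] by (simp add: divide_right_mono)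
  also have "\<dots> \<le> 2 / 13"
    using p by (intro divide_left_mono) auto
  finally show ?thesis by simp
qed

text \<open>The outer parts contribute at most 4/13 and the inner parts at most 2/676; 13 is the
  least prime p with 4/p < 1/3.\<close>

lemma theta_diff_small:
  assumes "t \<in> T" "u \<in> T"
  shows "\<bar>\<theta> t - \<theta> u\<bar> \<le> 1 / 3"
proof -
  obtain p j q k p' j' q' k' where tu: "t = ((p, j), (q, k))" "u = ((p', j'), (q', k'))"
    by (metis surj_pair)
  have mem: "(p, j) \<in> Ps \<times> freqs" "(p', j') \<in> Ps \<times> freqs" "(q, k) \<in> Qs \<times> freqs" "(q', k') \<in> Qs \<times> freqs"
    using assms tu by (auto simp: T_def)
  have "13 \<le> P" using mem(1) Ps by fastforce
  then have "13 ^ 2 \<le> (real P)\<^sup>2" by (intro power_mono) auto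
  then have e: "1 / (4 * (real P)\<^sup>2) \<le> 1 / (4 * 169)"
    using \<open>13 \<le> P\<close> by (intro divide_left_mono mult_left_mono) auto
  have "P > 0" using \<open>13 \<le> P\<close> by simp
  show ?thesis
    using order_trans[OF inner_freq_le[OF mem(3) \<open>P > 0\<close>] e] order_trans[OF inner_freq_le[OF mem(4) \<open>P > 0\<close>] e]
      outer_freq_le[OF mem(1)] outer_freq_le[OF mem(2)]
    unfolding tu \<theta>_def prod.case by linarith
qed

lemma D_le:
  assumes "t \<in> T" "u \<in> T" "\<theta> t \<noteq> \<theta> u"
  shows "D N (\<theta> t - \<theta> u) \<le> 1 / \<bar>\<theta> t - \<theta> u\<bar>"
  unfolding D_def using assms theta_diff_small by (intro norm_sum_cis_le) auto

text \<open>The common j / p cancels, leaving differences of fractions with denominators up to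
  \<open>Q\<close>.\<close>

lemma sum_same_outer_le:
  assumes a: "(p, j) \<in> Ps \<times> freqs" and b: "(q, k) \<in> Qs \<times> freqs"
  shows "(\<Sum>b'\<in>Qs \<times> freqs. D N (\<theta> ((p, j), (q, k)) - \<theta> ((p, j), b')))
    \<le> real N + 8 * (real Q)\<^sup>2 * harm (4 * Q)"
proof -
  have "(\<Sum>b'\<in>Qs \<times> freqs. D N (\<theta> ((p, j), (q, k)) - \<theta> ((p, j), b'))) =
     D N 0 + (\<Sum>b'\<in>Qs \<times> freqs - {(q, k)}. D N (\<theta> ((p, j), (q, k)) - \<theta> ((p, j), b')))"
    using b finite_Qs by (subst sum.remove[of _ "(q, k)"]) auto
  also have "D N 0 = real N"
    by (simp add: D_def)
  also have "(\<Sum>b'\<in>Qs \<times> freqs - {(q, k)}. D N (\<theta> ((p, j), (q, k)) - \<theta> ((p, j), b')))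
    \<le> (\<Sum>(q', k')\<in>Qs \<times> freqs - {(q, k)}. 1 / \<bar>real_of_int k / real q - real_of_int k' / real q'\<bar>)"
  proof (rule sum_mono)
    fix b' assume "b' \<in> Qs \<times> freqs - {(q, k)}"
    then obtain q' k' where qk: "b' = (q', k')" and b': "q' \<in> Qs" "k' \<in> freqs" "(q', k') \<noteq> (q, k)"
      by auto
    have "q > 0" "q' > 0" "real_of_int (k * int q' - k' * int q) \<noteq> 0"
      using b b' Qs prime_gt_0_nat fraction_numerator_nonzero[of q q' k k'] unfolding of_int_eq_0_iff by auto
    then have "real_of_int k / real q - real_of_int k' / real q' \<noteq> 0"
      by (subst fraction_diff_eq) auto
    then show "D N (\<theta> ((p, j), (q, k)) - \<theta> ((p, j), b')) \<le>
        (case b' of (q', k') \<Rightarrow> 1 / \<bar>real_of_int k / real q - real_of_int k' / real q'\<bar>)"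
      using D_le[of "((p, j), (q, k))" "((p, j), (q', k'))" N] a b b'
      by (simp add: T_def \<theta>_def qk)
  qed
  also have "\<dots> \<le> 8 * (real Q)\<^sup>2 * harm (4 * Q)"
    using b Qs finite_Qs by (intro sum_inverse_fraction_diff_le) auto
  finally show ?thesis by simp
qed

text \<open>The inner parts change a difference \<open>?d\<close> of outer parts by at most half of
  it, so each term is at most 2 / \<open>?d\<close>. There are at most 4Q inner pairs, which gives
  the factor 8Q.\<close>

lemma sum_other_outer_le:
  assumes a: "(p, j) \<in> Ps \<times> freqs" and b: "(q, k) \<in> Qs \<times> freqs"
  shows "(\<Sum>a'\<in>Ps \<times> freqs - {(p, j)}. \<Sum>b'\<in>Qs \<times> freqs. D N (\<theta> ((p, j), (q, k)) - \<theta> (a', b')))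
    \<le> 64 * real Q * (real P)\<^sup>2 * harm (4 * P)"
proof -
  have "(\<Sum>a'\<in>Ps \<times> freqs - {(p, j)}. \<Sum>b'\<in>Qs \<times> freqs. D N (\<theta> ((p, j), (q, k)) - \<theta> (a', b')))
    \<le> (\<Sum>a'\<in>Ps \<times> freqs - {(p, j)}. 8 * real Q *
        (case a' of (p', j') \<Rightarrow> 1 / \<bar>real_of_int j / real p - real_of_int j' / real p'\<bar>))"
  proof (rule sum_mono)
    fix a' assume "a' \<in> Ps \<times> freqs - {(p, j)}"
    then obtain p' j' where pj: "a' = (p', j')" and a': "p' \<in> Ps" "j' \<in> freqs" "(p', j') \<noteq> (p, j)"
      by auto
    let ?d = "\<bar>real_of_int j / real p - real_of_int j' / real p'\<bar>"
    have "P > 0" using a Ps by fastforce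
    have d: "1 / (real P)\<^sup>2 \<le> ?d"
      using a a' Ps by (intro fraction_diff_ge) auto
    then have "?d > 0" using \<open>P > 0\<close> by (smt (verit) divide_pos_pos of_nat_0_less_iff zero_less_power)
    have "D N (\<theta> ((p, j), (q, k)) - \<theta> ((p', j'), b')) \<le> 2 / ?d" if b': "b' \<in> Qs \<times> freqs" for b'
    proof -
      obtain q' k' where qk: "b' = (q', k')" by force
      have "1 / (4 * (real P)\<^sup>2) \<le> ?d / 4" using d by simp
      then have "\<bar>real_of_int k / real q\<bar> \<le> ?d / 4" "\<bar>real_of_int k' / real q'\<bar> \<le> ?d / 4"
        using order_trans[OF inner_freq_le[OF b \<open>P > 0\<close>]]
          order_trans[OF inner_freq_le[OF b'[unfolded qk] \<open>P > 0\<close>]] by blast+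
      then have le: "?d / 2 \<le> \<bar>\<theta> ((p, j), (q, k)) - \<theta> ((p', j'), b')\<bar>"
        unfolding qk \<theta>_def prod.case by (rule half_abs_diff_le)
      have "D N (\<theta> ((p, j), (q, k)) - \<theta> ((p', j'), b')) \<le> 1 / \<bar>\<theta> ((p, j), (q, k)) - \<theta> ((p', j'), b')\<bar>"
        using le \<open>?d > 0\<close> a a' b b' by (intro D_le) (auto simp: T_def)
      also have "\<dots> \<le> 1 / (?d / 2)"
        using le \<open>?d > 0\<close> by (intro divide_left_mono mult_pos_pos) auto
      finally show ?thesis by simp
    qed
    then have "(\<Sum>b'\<in>Qs \<times> freqs. D N (\<theta> ((p, j), (q, k)) - \<theta> ((p', j'), b')))
      \<le> (\<Sum>b'\<in>Qs \<times> freqs. 2 / ?d)"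
      by (intro sum_mono)
    also have "\<dots> = real (card Qs) * (8 / ?d)"
      by (simp add: card_cartesian_product)
    also have "\<dots> \<le> real Q * (8 / ?d)"
      using card_Qs_le by (intro mult_right_mono) auto
    finally show "(\<Sum>b'\<in>Qs \<times> freqs. D N (\<theta> ((p, j), (q, k)) - \<theta> (a', b')))
      \<le> 8 * real Q * (case a' of (p', j') \<Rightarrow> 1 / \<bar>real_of_int j / real p - real_of_int j' / real p'\<bar>)"
      by (simp add: pj mult_ac)
  qed
  also have "\<dots> = 8 * real Q * (\<Sum>(p', j')\<in>Ps \<times> freqs - {(p, j)}.
      1 / \<bar>real_of_int j / real p - real_of_int j' / real p'\<bar>)"
    by (simp only: sum_distrib_left)
  also have "\<dots> \<le> 8 * real Q * (8 * (real P)\<^sup>2 * harm (4 * P))"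
    using a Ps finite_Ps by (intro mult_left_mono sum_inverse_fraction_diff_le) auto
  finally show ?thesis by (simp add: algebra_simps)
qed

lemma sum_D_le:
  assumes "t \<in> T"
  shows "(\<Sum>u\<in>T. D N (\<theta> t - \<theta> u)) \<le> B N"
proof -
  obtain p j q k where t: "t = ((p, j), (q, k))" by (metis surj_pair)
  have mem: "(p, j) \<in> Ps \<times> freqs" "(q, k) \<in> Qs \<times> freqs"
    using assms t by (auto simp: T_def)
  have "(\<Sum>u\<in>T. D N (\<theta> t - \<theta> u)) =
     (\<Sum>a\<in>Ps \<times> freqs. \<Sum>b\<in>Qs \<times> freqs. D N (\<theta> t - \<theta> (a, b)))"
    unfolding T_def by (rule sum.cartesian_product')
  also have "\<dots> = (\<Sum>b\<in>Qs \<times> freqs. D N (\<theta> t - \<theta> ((p, j), b))) +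
     (\<Sum>a\<in>Ps \<times> freqs - {(p, j)}. \<Sum>b\<in>Qs \<times> freqs. D N (\<theta> t - \<theta> (a, b)))"
    using mem finite_Ps by (intro sum.remove) auto
  also have "\<dots> \<le> B N"
    unfolding B_def t using sum_same_outer_le[OF mem, of N] sum_other_outer_le[OF mem, of N] by linarith
  finally show ?thesis .
qed

end

subsection \<open>The test function\<close>

text \<open>A trigonometric polynomial of mean zero that is at least 1 on the middle half of the period.
  Mean zero is what matters: every frequency \<open>j / p\<close> below is then nonzero, so none is shared by
  two different primes.\<close>

definition test :: "real \<Rightarrow> real" where
  "test x = 2 * cos (2 * pi * x) - cos (4 * pi * x)"

text \<open>With c = cos (2 pi x), which lies in [0, 1] here, test x = 1 + 2 c (1 - c).\<close>

lemma test_ge_one: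
  assumes "\<bar>x\<bar> \<le> 1 / 4"
  shows "1 \<le> test x"
proof -
  have "0 \<le> cos (2 * pi * x)"
    using mult_left_mono[of x "1/4" "2 * pi"] mult_left_mono[of "- (1/4)" x "2 * pi"] assms
    by (intro cos_ge_zero) auto
  moreover have "cos (2 * pi * x) \<le> 1" by simp
  ultimately have "0 \<le> cos (2 * pi * x) * (1 - cos (2 * pi * x))" by simp
  moreover have "cos (4 * pi * x) = 2 * (cos (2 * pi * x))\<^sup>2 - 1"
    using cos_double_cos[of "2 * pi * x"] by (simp add: mult.assoc)
  ultimately show ?thesis
    unfolding test_def by (simp add: power2_eq_square algebra_simps)
qed

lemma test_add_of_int [simp]: "test (x + of_int m) = test x"
proof -
  have "2 * pi * (x + of_int m) = 2 * pi * x + 2 * pi * of_int m"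
    "4 * pi * (x + of_int m) = 4 * pi * x + 2 * pi * of_int (2 * m)"
    by (simp_all add: algebra_simps)
  then show ?thesis
    by (simp only: test_def cos_add cos_int_2pin sin_int_2pin) simp
qed

text \<open>For \<open>j\<close> in \<open>freqs\<close>, the Fourier coefficient at
  \<open>j\<close> of the translate of \<open>test\<close> by \<open>s\<close>.\<close>

definition weight :: "int \<Rightarrow> real \<Rightarrow> complex" where
  "weight j s = (if \<bar>j\<bar> = 1 then 1 else - (1 / 2)) * cis (- (2 * pi * of_int j * s))"

lemma norm_weight_le: "norm (weight j s) \<le> 1"
  by (simp add: weight_def norm_mult)

lemma test_expansion:
  "complex_of_real (test (y - s)) = (\<Sum>j\<in>freqs. weight j s * cis (2 * pi * of_int j * y))"
proof -
  have w: "weight j s * cis (2 * pi * of_int j * y) =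
      (if \<bar>j\<bar> = 1 then 1 else - (1 / 2)) * cis (2 * pi * of_int j * (y - s))" for j
    by (simp add: weight_def cis_mult right_diff_distrib)
  have "(\<Sum>j\<in>freqs. weight j s * cis (2 * pi * of_int j * y)) =
      cis (2 * pi * (y - s)) + cis (- (2 * pi * (y - s)))
      - (cis (4 * pi * (y - s)) + cis (- (4 * pi * (y - s)))) / 2"
    unfolding w by (simp add: freqs_def algebra_simps)
  also have "\<dots> = complex_of_real (test (y - s))"
    by (simp add: complex_eq_iff test_def)
  finally show ?thesis ..
qed

text \<open>With p = 2m + 1, the survivors are the residues a + k with m \<le> k \<le> 2m. They lie
  within m/2 < p/4 of their midpoint a + 3m/2.\<close>

lemma exists_test_centre:
  assumes "odd p" "interval_mod p ((p - 1) div 2) I"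
  shows "\<exists>c. \<forall>n. n mod p \<notin> I \<longrightarrow> 1 \<le> test (real n / real p - c)"
proof -
  obtain m where p: "p = 2 * m + 1" using assms(1) by (auto elim: oddE)
  obtain a where a: "a < p" "I = (\<lambda>k. (a + k) mod p) ` {..<m}"
    using assms(2) p by (auto simp: interval_mod_def)
  have "1 \<le> test (real n / real p - (a + 3 * m / 2) / real p)" if n: "n mod p \<notin> I" for n
  proof -
    \<comment> \<open>Adding \<open>p - a\<close> measures \<open>n\<close> from \<open>a\<close>
      within the naturals. The surplus \<open>p\<close> becomes the -1 in \<open>int d - 1\<close>,
      a whole number of periods.\<close>
    define k d where "k = (n + (p - a)) mod p" and "d = (n + (p - a)) div p"
    have nkd: "n + (p - a) = k + p * d"
      unfolding k_def d_def by (metis add.commute mult_div_mod_eq)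
    then have eq: "n + p = (a + k) + p * d" using a(1) by simp
    have "(a + k) mod p = n mod p"
      using arg_cong[OF eq, of "\<lambda>x. x mod p"] by simp
    then have "m \<le> k" using n a(2) by (metis imageI lessThan_iff not_le)
    have "k \<le> 2 * m" using p mod_less_divisor[of p "n + (p - a)"] unfolding k_def by linarith
    then have "real m \<le> real k" "real k \<le> 2 * real m" "real p = 2 * real m + 1"
      using \<open>m \<le> k\<close> p by auto
    then have k: "\<bar>real k - 3 * m / 2\<bar> \<le> real p / 4"
      unfolding abs_le_iff by linarith
    have "real n + real p = real a + real k + real p * real d"
      using eq by (metis of_nat_add of_nat_mult)
    then have "real n = real a + real k + real p * (real d - 1)"
      by (simp add: algebra_simps)
    moreover have "real p > 0" using p by simp
    ultimately have "real n / real p - (a + 3 * m / 2) / real p =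
        (real k - 3 * m / 2) / real p + of_int (int d - 1)"
      by (simp only: of_int_diff of_int_of_nat_eq of_int_1) (simp add: field_simps)
    moreover have "1 \<le> test ((real k - 3 * m / 2) / real p)"
      using k p by (intro test_ge_one) (simp add: abs_divide field_simps)
    ultimately show ?thesis by (simp only: test_add_of_int)
  qed
  then show ?thesis by blast
qed

subsection \<open>The sieve bound\<close>

context two_scales
begin

lemma B_nonneg: "0 \<le> B N"
  unfolding B_def by (intro add_nonneg_nonneg mult_nonneg_nonneg harm_nonneg) auto

lemma test_product_expansion:
  "complex_of_real ((\<Sum>p\<in>Ps. test (real n / real p - c p)) * (\<Sum>q\<in>Qs. test (real n / real q - c q))) =
   (\<Sum>t\<in>T. (case t of ((p, j), (q, k)) \<Rightarrow> weight j (c p) * weight k (c q)) * cis (2 * pi * real n * \<theta> t))"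
proof -
  have one: "complex_of_real (\<Sum>p\<in>R. test (real n / real p - c p)) =
      (\<Sum>(p, j)\<in>R \<times> freqs. weight j (c p) * cis (2 * pi * of_int j * (real n / real p)))" for R
    by (simp only: of_real_sum test_expansion sum.cartesian_product)
  show ?thesis
    unfolding of_real_mult one unfolding sum_product sum.cartesian_product T_def
  proof (intro sum.cong refl)
    fix t :: "(nat \<times> int) \<times> (nat \<times> int)"
    obtain p j q k where t: "t = ((p, j), (q, k))" by (metis surj_pair)
    have "cis (2 * pi * real n * \<theta> t) =
        cis (2 * pi * of_int j * (real n / real p)) * cis (2 * pi * of_int k * (real n / real q))"
      by (simp add: t \<theta>_def cis_mult algebra_simps)
    then show "(case t of (a, b) \<Rightarrow>
        (case a of (p, j) \<Rightarrow> weight j (c p) * cis (2 * pi * of_int j * (real n / real p))) *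
        (case b of (p, j) \<Rightarrow> weight j (c p) * cis (2 * pi * of_int j * (real n / real p)))) =
      (case t of ((p, j), (q, k)) \<Rightarrow> weight j (c p) * weight k (c q)) * cis (2 * pi * real n * \<theta> t)"
      by (simp only: t prod.case mult_ac)
  qed
qed

text \<open>A second moment argument: the squared product is at least M^2 on \<open>A\<close>, and
  its sum up to \<open>N\<close> is at most 16 M B(N).\<close>

lemma card_mult_le:
  assumes A: "A \<subseteq> {1..N}"
    and c: "\<And>n p. n \<in> A \<Longrightarrow> p \<in> Ps \<union> Qs \<Longrightarrow> 1 \<le> test (real n / real p - c p)"
  shows "real (card A) * (real (card Ps) * real (card Qs)) \<le> 16 * B N"
proof -
  define M where "M = real (card Ps) * real (card Qs)"
  define F where "F R n = (\<Sum>p\<in>R. test (real n / real p - c p))" for R and n :: nat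
  define w where "w t = (case t of ((p, j), (q, k)) \<Rightarrow> weight j (c p) * weight k (c q))"
    for t :: "(nat \<times> int) \<times> (nat \<times> int)"
  have M_le: "M \<le> F Ps n * F Qs n" if n: "n \<in> A" for n
  proof -
    have le: "real (card R) \<le> F R n" if "R \<subseteq> Ps \<union> Qs" for R
      using sum_mono[of R "\<lambda>_. 1" "\<lambda>p. test (real n / real p - c p)"] c[OF n] that
      by (auto simp: F_def)
    have "0 \<le> F Ps n" using le[of Ps] by (auto intro: order_trans[OF of_nat_0_le_iff])
    then show ?thesis unfolding M_def using le by (intro mult_mono) auto
  qed
  have "0 \<le> M" by (simp add: M_def)
  have "real (card A) * M\<^sup>2 = (\<Sum>n\<in>A. M\<^sup>2)" by simp
  also have "\<dots> \<le> (\<Sum>n\<in>A. (norm (complex_of_real (F Ps n * F Qs n)))\<^sup>2)"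
    using M_le \<open>0 \<le> M\<close> by (intro sum_mono power_mono) (simp_all only: norm_of_real abs_ge_self order_trans[OF _ abs_ge_self])
  also have "\<dots> \<le> (\<Sum>n=1..N. (norm (complex_of_real (F Ps n * F Qs n)))\<^sup>2)"
    using A by (intro sum_mono2) auto
  also have "\<dots> = (\<Sum>n=1..N. (norm (\<Sum>t\<in>T. w t * cis (2 * pi * real n * \<theta> t)))\<^sup>2)"
    unfolding F_def w_def test_product_expansion by (rule refl)
  also have "\<dots> \<le> real (card T) * B N"
  proof (rule sum_norm_square_exponential_le[OF finite_T])
    fix t assume "t \<in> T"
    show "norm (w t) \<le> 1"
      unfolding w_def by (cases t) (auto simp: norm_mult intro!: mult_le_one norm_weight_le)
    show "(\<Sum>u\<in>T. norm (\<Sum>n = 1..N. cis (2 * pi * real n * (\<theta> t - \<theta> u)))) \<le> B N"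
      using sum_D_le[OF \<open>t \<in> T\<close>, of N] by (simp only: D_def)
  qed
  also have "\<dots> = M * (16 * B N)"
    by (simp add: card_T M_def)
  finally have "M * (real (card A) * M) \<le> M * (16 * B N)"
    by (simp add: power2_eq_square mult_ac)
  \<comment> \<open>One factor \<open>M\<close> cancels unless it vanishes; in that case the claim
    is \<open>B_nonneg\<close>.\<close>
  then have "M = 0 \<or> real (card A) * M \<le> 16 * B N"
    using \<open>0 \<le> M\<close> by (auto simp: mult_le_cancel_left)
  then show ?thesis
    using B_nonneg[of N] unfolding M_def[symmetric] by auto
qed

end

text \<open>The difference of harm n and ln n decreases from its value 1 at n = 1.\<close>

lemma harm_le_ln:
  assumes "n \<ge> 1" "real n \<le> y"
  shows "harm n \<le> ln y + 1"
proof -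
  have "harm n - ln (real n) \<le> harm 1 - ln (real 1)"
    using decseqD[OF decseq_harm_diff_ln, of 0 "n - 1"] assms by simp
  moreover have "ln (real n) \<le> ln y" using assms by simp
  ultimately show ?thesis by (simp add: harm_expand)
qed

text \<open>Rounding down costs one more, hence 3 in place of 2.\<close>

lemma card_primes_upto_floor_ge:
  assumes "y \<ge> 2"
  shows "(y - 3) * ln 2 / ln y \<le> real (card (primes_upto (nat \<lfloor>y\<rfloor>)))"
proof -
  define n where "n = nat \<lfloor>y\<rfloor>"
  have n: "n \<ge> 2" "real n \<le> y" "y - 1 \<le> real n"
    using assms unfolding n_def by linarith+
  have "(y - 3) * ln 2 \<le> (real n - 2) * ln 2"
    using n by (intro mult_right_mono) auto
  also have "\<dots> \<le> real (card (primes_upto n)) * ln (real n)"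
    by (rule card_primes_upto_ge[OF n(1)])
  also have "\<dots> \<le> real (card (primes_upto n)) * ln y"
    using n by (intro mult_left_mono) auto
  finally show ?thesis
    using assms by (simp add: n_def field_simps)
qed

subsection \<open>Choice of the two scales\<close>

text \<open>A bound for \<open>16 * B N\<close> at x = N, with \<open>Q\<close>, \<open>P\<close>
  replaced by \<open>sqrt x\<close>, \<open>x powr (1 / 5)\<close> and harmonic numbers by
  logarithms.\<close>

definition majorant :: "real \<Rightarrow> real" where
  "majorant x = 16 * (x + 8 * x * (ln (4 * sqrt x) + 1)
     + 64 * sqrt x * (x powr (1 / 5))\<^sup>2 * (ln (4 * x powr (1 / 5)) + 1))"

text \<open>Chebyshev's bound less 12 for everything below 13; likewise \<open>inner_count\<close>
  gives up everything below 8 P^2.\<close>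

definition outer_count :: "real \<Rightarrow> real" where
  "outer_count x = (x powr (1 / 5) - 3) * ln 2 / ln (x powr (1 / 5)) - 12"

definition inner_count :: "real \<Rightarrow> real" where
  "inner_count x = (sqrt x - 3) * ln 2 / ln (sqrt x) - 8 * (x powr (1 / 5))\<^sup>2"

text \<open>The majorant has order x log x and the product of the counts x^(7/10) / (log x)^2, while
  1/3 + 7/10 > 1. Any exponent strictly between 1/6 and 1/4 would serve in place of 1/5: above 1/6
  for the last inequality, below 1/4 so that 8 P^2 is negligible against the primes up to sqrt
  x.\<close>

lemma eventually_counts:
  "eventually (\<lambda>x. 13 \<le> x powr (1 / 5) \<and> x powr (1 / 5) \<le> sqrt x \<and> 0 < outer_count x \<and> 0 < inner_count x \<and>
     majorant x \<le> x powr (1 / 3) * (outer_count x * inner_count x)) at_top"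
  unfolding outer_count_def inner_count_def majorant_def
  by (intro eventually_conj; real_asymp)

lemma card_sieved_set_le:
  fixes N :: nat and I :: "nat \<Rightarrow> nat set"
  defines "x \<equiv> real N"
  assumes I: "\<forall>p\<in>sieving_primes N. interval_mod p ((p - 1) div 2) (I p)"
    and x: "13 \<le> x powr (1 / 5)" "x powr (1 / 5) \<le> sqrt x" "0 < outer_count x" "0 < inner_count x"
  shows "real (card (sieved_set N I)) * (outer_count x * inner_count x) \<le> majorant x"
proof -
  define y P Q where "y = x powr (1 / 5)" and "P = nat \<lfloor>y\<rfloor>" and "Q = nat \<lfloor>sqrt x\<rfloor>"
  define Ps where "Ps = {p \<in> primes_upto P. 13 \<le> p}"
  define Qs where "Qs = {q \<in> primes_upto Q. 8 * P\<^sup>2 \<le> q}"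
  have y: "13 \<le> y" "y \<le> sqrt x" using x by (simp_all add: y_def)
  have P: "13 \<le> P" "real P \<le> y" using y(1) unfolding P_def by linarith+
  have Q: "1 \<le> Q" "real Q \<le> sqrt x" using y unfolding Q_def by linarith+
  \<comment> \<open>Thus 8 P^2 exceeds 2 and all primes in \<open>Qs\<close> are odd.\<close>
  have "1 \<le> P\<^sup>2" using P by simp
  interpret two_scales Ps Qs P Q
  proof
    fix p assume "p \<in> Ps"
    then show "prime p \<and> odd p \<and> 13 \<le> p \<and> p \<le> P"
      using prime_odd_nat[of p] by (auto simp: Ps_def primes_upto_def)
  next
    fix q assume "q \<in> Qs"
    then show "prime q \<and> odd q \<and> 8 * P\<^sup>2 \<le> q \<and> q \<le> Q"
      using prime_odd_nat[of q] \<open>1 \<le> P\<^sup>2\<close> by (auto simp: Qs_def primes_upto_def)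
  qed
  have sub: "Ps \<union> Qs \<subseteq> sieving_primes N"
  proof
    fix p assume p: "p \<in> Ps \<union> Qs"
    have "real p \<le> real P \<or> real p \<le> real Q" using p Ps Qs by auto
    then have "real p \<le> sqrt (real N)" using P Q y unfolding x_def by linarith
    then show "p \<in> sieving_primes N"
      using p Ps Qs by (auto simp: sieving_primes_def)
  qed
  have "\<exists>c. \<forall>n. n mod p \<notin> I p \<longrightarrow> 1 \<le> test (real n / real p - c)" if "p \<in> sieving_primes N" for p
    using that I by (intro exists_test_centre) (auto simp: sieving_primes_def)
  then obtain c where c: "\<And>p n. p \<in> sieving_primes N \<Longrightarrow> n mod p \<notin> I p \<Longrightarrow> 1 \<le> test (real n / real p - c p)"
    by metis
  have le: "real (card (sieved_set N I)) * (real (card Ps) * real (card Qs)) \<le> 16 * B N"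
  proof (rule card_mult_le)
    show "sieved_set N I \<subseteq> {1..N}" by (auto simp: sieved_set_def)
    fix n p assume "n \<in> sieved_set N I" "p \<in> Ps \<union> Qs"
    then show "1 \<le> test (real n / real p - c p)"
      using sub by (intro c) (auto simp: sieved_set_def)
  qed
  have "card (primes_upto P) \<le> card (Ps \<union> {1..12})"
    using finite_Ps by (intro card_mono) (auto simp: Ps_def primes_upto_def dest: prime_gt_0_nat)
  also have "\<dots> \<le> card Ps + 12"
    using card_Un_le[of Ps "{1..12}"] by simp
  finally have "real (card (primes_upto P)) \<le> real (card Ps) + 12" by linarith
  then have outer: "outer_count x \<le> real (card Ps)"
    using card_primes_upto_floor_ge[of y] y unfolding outer_count_def y_def[symmetric] P_def by linarith
  have "card (primes_upto Q) \<le> card (Qs \<union> {..<8 * P\<^sup>2})"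
    using finite_Qs by (intro card_mono) (auto simp: Qs_def)
  also have "\<dots> \<le> card Qs + 8 * P\<^sup>2"
    using card_Un_le[of Qs "{..<8 * P\<^sup>2}"] by simp
  finally have "real (card (primes_upto Q)) \<le> real (card Qs + 8 * P\<^sup>2)"
    by (simp only: of_nat_le_iff)
  also have "\<dots> \<le> real (card Qs) + 8 * y\<^sup>2"
    using P by simp
  finally have inner: "inner_count x \<le> real (card Qs)"
    using card_primes_upto_floor_ge[of "sqrt x"] y unfolding inner_count_def y_def[symmetric] Q_def by linarith
  have "B N \<le> x + 8 * x * (ln (4 * sqrt x) + 1) + 64 * sqrt x * y\<^sup>2 * (ln (4 * y) + 1)"
  proof -
    have "(real Q)\<^sup>2 \<le> x"
      using Q power_mono[of "real Q" "sqrt x" 2] by (simp add: x_def)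
    moreover have "harm (4 * Q) \<le> ln (4 * sqrt x) + 1" "harm (4 * P) \<le> ln (4 * y) + 1"
      using P Q by (auto intro!: harm_le_ln)
    ultimately show ?thesis
      unfolding B_def x_def[symmetric] using P Q y
      by (intro add_mono mult_mono power_mono order_refl mult_nonneg_nonneg harm_nonneg) (auto simp: x_def)
  qed
  then have "16 * B N \<le> majorant x" by (simp add: majorant_def y_def)
  moreover have "real (card (sieved_set N I)) * (outer_count x * inner_count x)
      \<le> real (card (sieved_set N I)) * (real (card Ps) * real (card Qs))"
    using outer inner x by (intro mult_left_mono mult_mono) auto
  ultimately show ?thesis using le by linarith
qed

section \<open>The bound for every N\<close>

theorem theorem1p5:
  fixes \<epsilon> :: real
  assumes "\<epsilon> > 0"
  shows "\<exists>C::real. \<forall>N::nat. N \<ge> 1 \<longrightarrow>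
           (\<forall>I :: nat \<Rightarrow> nat set.
              (\<forall>p\<in>sieving_primes N. interval_mod p ((p - 1) div 2) (I p)) \<longrightarrow>
              real (card (sieved_set N I)) \<le> C * real N powr (1 / 3 + \<epsilon>))"
proof -
  obtain X where X: "\<And>x. x \<ge> X \<Longrightarrow> 13 \<le> x powr (1 / 5) \<and> x powr (1 / 5) \<le> sqrt x \<and>
      0 < outer_count x \<and> 0 < inner_count x \<and>
      majorant x \<le> x powr (1 / 3) * (outer_count x * inner_count x)"
    using eventually_counts unfolding eventually_at_top_linorder by blast
  \<comment> \<open>From \<open>X\<close> on the count is at most N^(1/3). Below \<open>X\<close>
    the trivial bound \<open>N\<close> is less than \<open>X\<close>, and the power of
    \<open>N\<close> is at least 1.\<close>
  have "real (card (sieved_set N I)) \<le> max 1 X * real N powr (1 / 3 + \<epsilon>)"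
    if N: "N \<ge> 1" and I: "\<forall>p\<in>sieving_primes N. interval_mod p ((p - 1) div 2) (I p)" for N I
  proof (cases "real N \<ge> X")
    case True
    let ?M = "outer_count (real N) * inner_count (real N)"
    have "real (card (sieved_set N I)) * ?M \<le> majorant (real N)"
      using X[OF True] I by (intro card_sieved_set_le) auto
    also have "\<dots> \<le> real N powr (1 / 3) * ?M"
      using X[OF True] by blast
    finally have "real (card (sieved_set N I)) \<le> real N powr (1 / 3)"
      using X[OF True] by (auto simp: mult_le_cancel_right)
    also have "\<dots> \<le> 1 * real N powr (1 / 3 + \<epsilon>)"
      using N assms by (simp add: powr_mono)
    also have "\<dots> \<le> max 1 X * real N powr (1 / 3 + \<epsilon>)"
      by (intro mult_right_mono) auto
    finally show ?thesis .
  next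
    case False
    have "sieved_set N I \<subseteq> {1..N}" by (auto simp: sieved_set_def)
    then have "card (sieved_set N I) \<le> N"
      using card_mono[of "{1..N}"] by fastforce
    then have "real (card (sieved_set N I)) \<le> max 1 X * 1" using False by auto
    also have "\<dots> \<le> max 1 X * real N powr (1 / 3 + \<epsilon>)"
      using N assms by (intro mult_left_mono ge_one_powr_ge_zero) auto
    finally show ?thesis .
  qed
  then show ?thesis by blast
qed

end
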